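(* Let $a,b \in \mathcal{B}(\mathbb{C}^2)$ be nonzero commuting normal operators with $\|a\|_2/\|a\| \geq \|b\|_2/\|b\|$, and let $T_{a,b}\colon \mathcal{B}(\mathbb{C}^2)\to\mathcal{B}(\mathbb{C}^2)$ be given by $T_{a,b}(x) = axb+bxa$. If $a$ and $b$ attain their norms at a common unit vector (that is, there is a unit vector $\xi\in\mathbb{C}^2$ with $\|a\xi\| = \|a\|$ and $\|b\xi\|=\|b\|$), then $\left\|T_{a,b}\right\| = 2\|a\|\,\|b\|$. If not, then: (i) if $\|a\|_2 \geq \sqrt{3/2}\,\|a\|$ and $\|b\|_2^2 < 3\|b\|^2 - \dfrac{\|a\|^2\|b\|^2}{\|a\|_2^2 - \|a\|^2}$, then $$\left\|T_{a,b}\right\| = 2\|b\|\sqrt{\|a\|_2^2 - \|a\|^2};$$ (ii) otherwise, $$\left\|T_{a,b}\right\| = \frac{\|a\|_2^2\|b\|^2 + \|a\|^2\|b\|_2^2 - \|a\|_2^2\|b\|_2^2}{\sqrt{(2\|a\|^2 - \|a\|_2^2)(2\|b\|^2 - \|b\|_2^2)}}.$$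
   Context: $\mathcal{B}(\mathbb{C}^2)$ is the algebra of complex $2\times 2$ matrices; $\|\cdot\|$ on it is the operator norm with respect to the Euclidean norm on $\mathbb{C}^2$, and $\|x\|_2$ is the Hilbert-Schmidt norm, $\|x\|_2^2 = \operatorname{trace}(x^*x)$. $\|T_{a,b}\|$ is the norm of $T_{a,b}$ as a linear operator on $\mathcal{B}(\mathbb{C}^2)$ with the operator norm. *)

theory Defs
  imports "HOL-Analysis.Analysis"
begin

text \<open>The norm of the type \<^typ>\<open>complex ^ 2\<close> is the Euclidean norm, so \<^const>\<open>onorm\<close> of
  \<open>\<lambda>v. A *v v\<close> is the operator norm. It differs from the norm of the type \<^typ>\<open>complex ^ 2 ^ 2\<close>.\<close>

definition op_norm :: "complex ^ 2 ^ 2 \<Rightarrow> real" where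
  "op_norm A = onorm (\<lambda>v. A *v v)"

definition conj_transpose :: "complex ^ 2 ^ 2 \<Rightarrow> complex ^ 2 ^ 2" where
  "conj_transpose A = (\<chi> i j. cnj (A $ j $ i))"

text \<open>The trace below is real and nonnegative, so \<^const>\<open>Re\<close> loses nothing.\<close>

definition hs_norm :: "complex ^ 2 ^ 2 \<Rightarrow> real" where
  "hs_norm A = sqrt (Re (trace (conj_transpose A ** A)))"

definition normal_op :: "complex ^ 2 ^ 2 \<Rightarrow> bool" where
  "normal_op A \<longleftrightarrow> conj_transpose A ** A = A ** conj_transpose A"

definition T_op :: "complex ^ 2 ^ 2 \<Rightarrow> complex ^ 2 ^ 2 \<Rightarrow> complex ^ 2 ^ 2 \<Rightarrow> complex ^ 2 ^ 2" where
  "T_op a b x = a ** x ** b + b ** x ** a"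

text \<open>The analogue of \<^const>\<open>onorm\<close> for linear maps on matrices, with \<^const>\<open>op_norm\<close> on both
  sides. \<^const>\<open>onorm\<close> itself would use the norm of the type \<^typ>\<open>complex ^ 2 ^ 2\<close>, which is the
  Hilbert-Schmidt norm. For linear \<open>T\<close> the supremum is over a bounded set, by finite
  dimensionality; \<open>x = 0\<close> contributes \<open>0 / 0 = 0\<close>.\<close>

definition superop_norm :: "(complex ^ 2 ^ 2 \<Rightarrow> complex ^ 2 ^ 2) \<Rightarrow> real" where
  "superop_norm T = (SUP x. op_norm (T x) / op_norm x)"

definition common_norming_vector :: "complex ^ 2 ^ 2 \<Rightarrow> complex ^ 2 ^ 2 \<Rightarrow> bool" where
  "common_norming_vector a b \<longleftrightarrow>
     (\<exists>\<xi>. norm \<xi> = 1 \<and> norm (a *v \<xi>) = op_norm a \<and> norm (b *v \<xi>) = op_norm b)"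

end

(*
  Commuting normal matrices are simultaneously unitarily diagonalizable, so let a = diag(a1, a2)
  and b = diag(b1, b2). For unit vectors v, w and any q > 0, Cauchy-Schwarz gives
    |<(axb + bxa)v, w>| <= |x| (|bv| |aw| + |av| |bw|) <= |x| f(v) f(w) / q,
  where f(v)^2 = |av|^2 + q^2 |bv|^2 is at most the larger of |a1|^2 + q^2 |b1|^2 and
  |a2|^2 + q^2 |b2|^2. If a and b attain their norms at a common basis vector, or if
  |a1|^2 |b2|^2 + |a2|^2 |b1|^2 <= 2 |a2|^2 |b2|^2, then the bound for a suitable q is attained at
  the diagonal matrix unit at index 1 or 2. In the remaining case the best q makes f constant on the
  unit sphere, and the bound is attained at an explicit multiple of a unitary matrix.
*)

theory Submission
  imports Defs
begin

subsection \<open>Unitary equivalence\<close>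

lemma matrix_2_eq_iff:
  fixes A B :: "'a ^ 2 ^ 2"
  shows "A = B \<longleftrightarrow> A $ 1 $ 1 = B $ 1 $ 1 \<and> A $ 1 $ 2 = B $ 1 $ 2 \<and> A $ 2 $ 1 = B $ 2 $ 1 \<and> A $ 2 $ 2 = B $ 2 $ 2"
  by (auto simp: vec_eq_iff forall_2)

lemma matrix_mult_2_nth [simp]:
  fixes A B :: "'a::semiring_1 ^ 2 ^ 2"
  shows "(A ** B) $ i $ j = A $ i $ 1 * B $ 1 $ j + A $ i $ 2 * B $ 2 $ j"
  by (simp add: matrix_matrix_mult_def sum_2)

lemma matrix_vector_2_nth [simp]:
  fixes A :: "'a::semiring_1 ^ 2 ^ 2"
  shows "(A *v v) $ i = A $ i $ 1 * v $ 1 + A $ i $ 2 * v $ 2"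
  by (simp add: matrix_vector_mult_def sum_2)

lemma conj_transpose_nth [simp]: "conj_transpose A $ i $ j = cnj (A $ j $ i)"
  by (simp add: conj_transpose_def)

lemma conj_transpose_mult: "conj_transpose (A ** B) = conj_transpose B ** conj_transpose A"
  by (simp add: matrix_2_eq_iff algebra_simps)

lemma conj_transpose_conj_transpose [simp]: "conj_transpose (conj_transpose A) = A"
  by (simp add: matrix_2_eq_iff)

lemma norm_complex_2: "(norm (v :: complex ^ 2))\<^sup>2 = (cmod (v $ 1))\<^sup>2 + (cmod (v $ 2))\<^sup>2"
  by (simp add: norm_vec_def L2_set_def sum_2)

lemma inner_conj_transpose:
  fixes v w :: "complex ^ 2"
  shows "inner (A *v v) w = inner v (conj_transpose A *v w)"
  by (simp add: inner_vec_def sum_2 inner_complex_def algebra_simps)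

definition unitary :: "complex ^ 2 ^ 2 \<Rightarrow> bool" where
  "unitary U \<longleftrightarrow> conj_transpose U ** U = mat 1"

definition conjugate :: "complex ^ 2 ^ 2 \<Rightarrow> complex ^ 2 ^ 2 \<Rightarrow> complex ^ 2 ^ 2" where
  "conjugate U A = U ** A ** conj_transpose U"

lemma unitary_right: "unitary U \<Longrightarrow> U ** conj_transpose U = mat 1"
  unfolding unitary_def by (simp add: matrix_left_right_inverse)

lemma unitary_conj_transpose: "unitary U \<Longrightarrow> unitary (conj_transpose U)"
  using unitary_right by (simp add: unitary_def)

lemma unitary_mult: "unitary U \<Longrightarrow> unitary V \<Longrightarrow> unitary (U ** V)"
  unfolding unitary_def conj_transpose_mult
  by (metis matrix_mul_assoc matrix_mul_lid)

lemma norm_unitary: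
  assumes "unitary U"
  shows "norm (U *v v) = norm v"
proof -
  have "inner (U *v v) (U *v v) = inner v v"
    using assms by (simp only: inner_conj_transpose matrix_vector_mul_assoc unitary_def matrix_vector_mul_lid)
  then show ?thesis by (simp add: norm_eq_sqrt_inner)
qed

lemma conjugate_mult:
  assumes "unitary U"
  shows "conjugate U (A ** B) = conjugate U A ** conjugate U B"
proof -
  have "conjugate U A ** conjugate U B = U ** A ** (conj_transpose U ** U) ** B ** conj_transpose U"
    by (simp only: conjugate_def matrix_mul_assoc)
  also have "\<dots> = conjugate U (A ** B)"
    using assms unfolding unitary_def conjugate_def by (simp only: matrix_mul_rid matrix_mul_assoc)
  finally show ?thesis by simp
qed

lemma conjugate_add: "conjugate U (A + B) = conjugate U A + conjugate U B"
  by (simp add: conjugate_def matrix_2_eq_iff algebra_simps)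

lemma conjugate_conj_transpose: "conj_transpose (conjugate U A) = conjugate U (conj_transpose A)"
  by (simp add: conjugate_def conj_transpose_mult matrix_mul_assoc)

lemma conjugate_conjugate: "conjugate U (conjugate V A) = conjugate (U ** V) A"
  by (simp add: conjugate_def conj_transpose_mult matrix_mul_assoc)

lemma conjugate_mat_1: "conjugate (mat 1) A = A"
  by (simp add: conjugate_def matrix_2_eq_iff mat_def)

lemma conjugate_inverse:
  assumes "unitary U"
  shows "conjugate U (conjugate (conj_transpose U) A) = A"
    and "conjugate (conj_transpose U) (conjugate U A) = A"
  using assms by (simp_all only: conjugate_conjugate unitary_right conjugate_mat_1) (simp add: unitary_def conjugate_mat_1)

lemma conjugate_normal_op:
  assumes "unitary U"
  shows "normal_op (conjugate U A) \<longleftrightarrow> normal_op A"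
  unfolding normal_op_def conjugate_conj_transpose conjugate_mult[OF assms, symmetric]
  by (metis assms conjugate_inverse(2))

section \<open>Unitary invariance of the norms and of common norming vectors\<close>

lemma bounded_linear_mult_vec: "bounded_linear (\<lambda>v. (A :: complex ^ 2 ^ 2) *v v)"
  by (rule matrix_vector_mul_bounded_linear)

lemma norm_mult_vec_le: "norm (A *v v) \<le> op_norm A * norm v"
  unfolding op_norm_def by (rule onorm[OF bounded_linear_mult_vec])

lemma op_norm_nonneg: "0 \<le> op_norm A"
  unfolding op_norm_def by (rule onorm_pos_le[OF bounded_linear_mult_vec])

lemma op_norm_le: "(\<And>v. norm (A *v v) \<le> c * norm v) \<Longrightarrow> op_norm A \<le> c"
  unfolding op_norm_def by (rule onorm_le)

lemma op_norm_ge: "norm (A *v v) = c * norm v \<Longrightarrow> v \<noteq> 0 \<Longrightarrow> c \<le> op_norm A"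
  using norm_mult_vec_le[of A v] by simp

lemma op_norm_conjugate_le:
  assumes "unitary U"
  shows "op_norm (conjugate U A) \<le> op_norm A"
proof (rule op_norm_le)
  fix v
  have "norm (conjugate U A *v v) = norm (A *v (conj_transpose U *v v))"
    using norm_unitary[OF assms] by (simp only: conjugate_def matrix_vector_mul_assoc[symmetric])
  also have "\<dots> \<le> op_norm A * norm (conj_transpose U *v v)" by (rule norm_mult_vec_le)
  also have "\<dots> = op_norm A * norm v" by (simp only: norm_unitary[OF unitary_conj_transpose[OF assms]])
  finally show "norm (conjugate U A *v v) \<le> op_norm A * norm v" .
qed

lemma op_norm_conjugate:
  assumes "unitary U"
  shows "op_norm (conjugate U A) = op_norm A"
  using op_norm_conjugate_le[OF assms, of A]
    op_norm_conjugate_le[OF unitary_conj_transpose[OF assms], of "conjugate U A"]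
  by (simp add: conjugate_inverse[OF assms])

lemma hs_norm_conjugate:
  assumes "unitary U"
  shows "hs_norm (conjugate U A) = hs_norm A"
proof -
  have "trace (conjugate U B) = trace B" for B
    using assms unfolding conjugate_def unitary_def
    by (metis trace_mul_sym matrix_mul_assoc matrix_mul_lid)
  then show ?thesis
    unfolding hs_norm_def conjugate_conj_transpose conjugate_mult[OF assms, symmetric] by simp
qed

text \<open>\<open>conjugate U\<close> is a bijection of the matrices that preserves
  \<open>op_norm\<close> and intertwines the two maps, so both suprema run over the same set of
  quotients.\<close>

lemma superop_norm_conjugate:
  assumes "unitary U"
  shows "superop_norm (T_op (conjugate U a) (conjugate U b)) = superop_norm (T_op a b)"
proof -
  have T: "T_op (conjugate U a) (conjugate U b) (conjugate U x) = conjugate U (T_op a b x)" for x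
    by (simp add: T_op_def conjugate_mult[OF assms] conjugate_add)
  have "surj (conjugate U)"
    by (rule surjI) (rule conjugate_inverse(1)[OF assms])
  then have "range f = range (\<lambda>x. f (conjugate U x))" for f :: "complex ^ 2 ^ 2 \<Rightarrow> real"
    by (metis image_image)
  from this[of "\<lambda>x. op_norm (T_op (conjugate U a) (conjugate U b) x) / op_norm x"]
  show ?thesis by (simp add: superop_norm_def T op_norm_conjugate[OF assms])
qed

lemma common_norming_vector_conjugate_imp:
  assumes "unitary U" "common_norming_vector a b"
  shows "common_norming_vector (conjugate U a) (conjugate U b)"
proof -
  obtain v where v: "norm v = 1" "norm (a *v v) = op_norm a" "norm (b *v v) = op_norm b"
    using assms(2) unfolding common_norming_vector_def by blast
  \<comment> \<open>Common norming vectors are transported by \<open>U\<close>: the witness below is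
    \<open>U *v v\<close>.\<close>
  have N: "norm (conjugate U A *v (U *v v)) = norm (A *v v)" for A
  proof -
    have "conjugate U A *v (U *v v) = U *v (A *v ((conj_transpose U ** U) *v v))"
      by (simp only: conjugate_def matrix_vector_mul_assoc matrix_mul_assoc)
    then show ?thesis
      using assms(1) by (simp only: unitary_def matrix_vector_mul_lid norm_unitary[OF assms(1)])
  qed
  show ?thesis
    unfolding common_norming_vector_def op_norm_conjugate[OF assms(1)]
    by (rule exI[of _ "U *v v"]) (use v N norm_unitary[OF assms(1)] in metis)
qed

lemma common_norming_vector_conjugate:
  assumes "unitary U"
  shows "common_norming_vector (conjugate U a) (conjugate U b) \<longleftrightarrow> common_norming_vector a b"
  using common_norming_vector_conjugate_imp[OF assms]
    common_norming_vector_conjugate_imp[OF unitary_conj_transpose[OF assms]] conjugate_inverse[OF assms]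
  by metis

subsection \<open>Simultaneous diagonalization\<close>

definition mat2 :: "complex \<Rightarrow> complex \<Rightarrow> complex \<Rightarrow> complex \<Rightarrow> complex ^ 2 ^ 2" where
  "mat2 p q r s = vector [vector [p, q], vector [r, s]]"

abbreviation diag2 :: "complex \<Rightarrow> complex \<Rightarrow> complex ^ 2 ^ 2" where
  "diag2 p s \<equiv> mat2 p 0 0 s"

lemma mat2_nth [simp]:
  "mat2 p q r s $ 1 $ 1 = p" "mat2 p q r s $ 1 $ 2 = q" "mat2 p q r s $ 2 $ 1 = r" "mat2 p q r s $ 2 $ 2 = s"
  by (simp_all add: mat2_def vector_2)

text \<open>A root \<open>l\<close> of the characteristic polynomial comes from the quadratic
  formula. Each of \<open>(q, l - p)\<close> and \<open>(l - s, r)\<close> solves the eigenvector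
  equations. Both vanish only for a scalar matrix, and then any vector will do.\<close>

lemma eigenvector_exists:
  fixes A :: "complex ^ 2 ^ 2"
  obtains l x y where "(x, y) \<noteq> (0, 0)"
    "A $ 1 $ 1 * x + A $ 1 $ 2 * y = l * x" "A $ 2 $ 1 * x + A $ 2 $ 2 * y = l * y"
proof -
  define p q r s where d: "p = A $ 1 $ 1" "q = A $ 1 $ 2" "r = A $ 2 $ 1" "s = A $ 2 $ 2"
  define c where "c = csqrt ((p - s)\<^sup>2 + 4 * q * r)"
  define l where "l = (p + s + c) / 2"
  have c: "c * c = (p - s) * (p - s) + 4 * q * r"
    unfolding c_def power2_eq_square[symmetric] by simp
  have l: "(l - p) * (l - s) = q * r"
    using c unfolding l_def by (simp add: field_simps)
  consider "(q, l - p) \<noteq> (0, 0)" | "(l - s, r) \<noteq> (0, 0)" | "q = 0" "r = 0" "l = p" "l = s" by auto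
  then show thesis
  proof cases
    case 1
    then show ?thesis using l by (intro that[of q "l - p" l]) (auto simp: d[symmetric] algebra_simps)
  next
    case 2
    then show ?thesis using l by (intro that[of "l - s" r l]) (auto simp: d[symmetric] algebra_simps)
  next
    case 3
    then show ?thesis by (intro that[of 1 0 l]) (auto simp: d[symmetric])
  qed
qed

text \<open>A unit eigenvector as the first column of \<open>U\<close> makes the matrix upper
  triangular, and a normal triangular matrix is diagonal.\<close>

lemma normal_op_diagonalizable:
  assumes "normal_op A"
  obtains U p s where "unitary U" "A = conjugate U (diag2 p s)"
proof -
  obtain l x y where xy: "(x, y) \<noteq> (0, 0)"
    and e: "A $ 1 $ 1 * x + A $ 1 $ 2 * y = l * x" "A $ 2 $ 1 * x + A $ 2 $ 2 * y = l * y"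
    by (rule eigenvector_exists)
  define n where "n = sqrt ((cmod x)\<^sup>2 + (cmod y)\<^sup>2)"
  define u v where uv: "u = x / of_real n" "v = y / of_real n"
  have n: "n > 0" using xy unfolding n_def by (auto simp: add_pos_nonneg add_nonneg_pos)
  have e': "A $ 1 $ 1 * u + A $ 1 $ 2 * v = l * u" "A $ 2 $ 1 * u + A $ 2 $ 2 * v = l * v"
    using e n unfolding uv by (simp_all add: field_simps)
  have "(cmod u)\<^sup>2 + (cmod v)\<^sup>2 = 1"
    using n unfolding uv
    by (simp add: norm_divide power_divide add_divide_distrib[symmetric]) (simp add: n_def)
  then have "complex_of_real ((cmod u)\<^sup>2 + (cmod v)\<^sup>2) = 1" by simp
  then have N: "u * cnj u + v * cnj v = 1" by (simp add: complex_norm_square[symmetric])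
  \<comment> \<open>The second column is the unit vector orthogonal to the eigenvector
    \<open>(u, v)\<close>.\<close>
  define U where "U = mat2 u (- cnj v) v (cnj u)"
  have U: "unitary U" using N by (simp add: unitary_def U_def matrix_2_eq_iff mat_def algebra_simps)
  define B where "B = conjugate (conj_transpose U) A"
  have AB: "A = conjugate U B" unfolding B_def by (simp add: conjugate_inverse[OF U])
  have "normal_op B" using assms U unfolding AB by (simp add: conjugate_normal_op)
  then have nB: "(conj_transpose B ** B) $ 1 $ 1 = (B ** conj_transpose B) $ 1 $ 1"
    unfolding normal_op_def by simp
  have "B $ 2 $ 1 = u * (A $ 2 $ 1 * u + A $ 2 $ 2 * v) - v * (A $ 1 $ 1 * u + A $ 1 $ 2 * v)"
    unfolding B_def conjugate_def U_def by (simp add: algebra_simps)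
  then have B21: "B $ 2 $ 1 = 0" unfolding e' by (simp add: algebra_simps)
  \<comment> \<open>The (1,1) entries in \<open>nB\<close> are |B11|^2 + |B21|^2 and |B11|^2 +
    |B12|^2, so |B12| = |B21| = 0.\<close>
  have B12: "B $ 1 $ 2 = 0" using nB by (simp add: B21)
  have "B = diag2 (B $ 1 $ 1) (B $ 2 $ 2)" by (simp add: matrix_2_eq_iff B12 B21)
  then show thesis using that U AB by metis
qed

text \<open>Once \<open>a\<close> is diagonal, either it is scalar and stays so under the further
  conjugation that diagonalizes \<open>b\<close>, or its diagonal entries differ and commutation
  kills the off-diagonal entries of \<open>b\<close>.\<close>

lemma commuting_normal_diagonalizable:
  assumes "normal_op a" "normal_op b" "a ** b = b ** a"
  obtains U a1 a2 b1 b2 where "unitary U" "a = conjugate U (diag2 a1 a2)" "b = conjugate U (diag2 b1 b2)"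
proof -
  obtain U p s where U: "unitary U" and a: "a = conjugate U (diag2 p s)"
    using normal_op_diagonalizable[OF assms(1)] .
  define B where "B = conjugate (conj_transpose U) b"
  have b: "b = conjugate U B" unfolding B_def by (simp add: conjugate_inverse[OF U])
  have comm: "diag2 p s ** B = B ** diag2 p s"
    using assms(3) unfolding a b conjugate_mult[OF U, symmetric] by (metis U conjugate_inverse(2))
  show thesis
  proof (cases "p = s")
    case True
    have "normal_op B" using assms(2) U unfolding b by (simp add: conjugate_normal_op)
    then obtain V q r where V: "unitary V" "B = conjugate V (diag2 q r)"
      using normal_op_diagonalizable by metis
    have "conjugate V (diag2 p p) = mat2 p 0 0 p ** (V ** conj_transpose V)"
      by (simp add: conjugate_def matrix_2_eq_iff algebra_simps)
    then have "conjugate V (diag2 p p) = diag2 p p"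
      by (simp only: unitary_right[OF V(1)] matrix_mul_rid)
    then show ?thesis
      using that[OF unitary_mult[OF U V(1)], of p p q r] a b V(2) True by (simp flip: conjugate_conjugate)
  next
    case False
    have "B = diag2 (B $ 1 $ 1) (B $ 2 $ 2)"
      using comm False by (auto simp: matrix_2_eq_iff mult.commute)
    then show ?thesis using that U a b by metis
  qed
qed

lemma commuting_normal_diagonalizable_ordered:
  assumes "normal_op a" "normal_op b" "a ** b = b ** a"
  obtains U a1 a2 b1 b2 where "unitary U" "a = conjugate U (diag2 a1 a2)" "b = conjugate U (diag2 b1 b2)"
    "cmod a2 \<le> cmod a1"
proof -
  obtain U a1 a2 b1 b2 where U: "unitary U" and ab: "a = conjugate U (diag2 a1 a2)" "b = conjugate U (diag2 b1 b2)"
    using commuting_normal_diagonalizable[OF assms] .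
  \<comment> \<open>Conjugation by this permutation matrix swaps the two indices, so
    \<open>a\<close> can be taken to attain its norm at index 1.\<close>
  define J where "J = mat2 0 1 1 0"
  have J: "unitary J" "conjugate J (diag2 p s) = diag2 s p" for p s
    by (simp_all add: J_def unitary_def conjugate_def matrix_2_eq_iff mat_def)
  show thesis
  proof (cases "cmod a2 \<le> cmod a1")
    case False
    then show ?thesis
      using that[OF unitary_mult[OF U J(1)], of a2 a1 b2 b1] ab J(2) by (simp flip: conjugate_conjugate)
  qed (use that U ab in blast)
qed

subsection \<open>Norms for diagonal matrices\<close>

lemma op_norm_diag2: "op_norm (diag2 p s) = max (cmod p) (cmod s)"
proof (rule antisym)
  show "op_norm (diag2 p s) \<le> max (cmod p) (cmod s)"
  proof (rule op_norm_le, rule power2_le_imp_le)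
    fix v :: "complex ^ 2"
    let ?m = "max (cmod p) (cmod s)"
    have "(cmod p)\<^sup>2 * (cmod (v $ 1))\<^sup>2 + (cmod s)\<^sup>2 * (cmod (v $ 2))\<^sup>2 \<le> ?m\<^sup>2 * (cmod (v $ 1))\<^sup>2 + ?m\<^sup>2 * (cmod (v $ 2))\<^sup>2"
      by (intro add_mono mult_right_mono power_mono) auto
    then show "(norm (diag2 p s *v v))\<^sup>2 \<le> (?m * norm v)\<^sup>2"
      by (simp add: norm_complex_2 norm_mult power_mult_distrib distrib_left)
  qed (simp add: le_max_iff_disj)
  have "norm (diag2 p s *v axis 1 1) = cmod p * norm (axis 1 1 :: complex ^ 2)"
    by (rule power2_eq_imp_eq) (simp_all add: norm_complex_2 power_mult_distrib axis_def)
  moreover have "norm (diag2 p s *v axis 2 1) = cmod s * norm (axis 2 1 :: complex ^ 2)"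
    by (rule power2_eq_imp_eq) (simp_all add: norm_complex_2 power_mult_distrib axis_def)
  ultimately show "max (cmod p) (cmod s) \<le> op_norm (diag2 p s)"
    by (metis axis_eq_0_iff max.bounded_iff op_norm_ge zero_neq_one)
qed

lemma hs_norm_diag2_sq: "(hs_norm (diag2 p s))\<^sup>2 = (cmod p)\<^sup>2 + (cmod s)\<^sup>2"
  by (simp add: hs_norm_def trace_def sum_2 cmod_power2 algebra_simps flip: power2_eq_square)

section \<open>The upper bound from a weighted Cauchy-Schwarz inequality\<close>

lemma superop_norm_eqI:
  assumes "\<And>x. op_norm (T x) \<le> c * op_norm x" and "c * op_norm x0 \<le> op_norm (T x0)" and "op_norm x0 > 0"
  shows "superop_norm T = c"
proof -
  \<comment> \<open>Needed for those \<open>x\<close> with \<open>op_norm x = 0\<close>, where the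
    quotient is 0 by convention.\<close>
  have c: "0 \<le> c"
    using assms(1)[of x0] assms(3) op_norm_nonneg[of "T x0"] by (meson dual_order.trans linorder_not_less mult_neg_pos)
  have le: "op_norm (T x) / op_norm x \<le> c" for x
    using assms(1)[of x] op_norm_nonneg[of x] c by (cases "op_norm x = 0") (simp_all add: field_simps)
  have "c \<le> op_norm (T x0) / op_norm x0" using assms(2,3) by (simp add: field_simps)
  moreover have "op_norm (T x0) / op_norm x0 \<le> superop_norm T"
    unfolding superop_norm_def by (rule cSUP_upper) (auto intro: bdd_aboveI2 le)
  moreover have "superop_norm T \<le> c" unfolding superop_norm_def by (rule cSUP_least) (auto intro: le)
  ultimately show ?thesis by linarith
qed

text \<open>Cauchy-Schwarz for the vectors \<open>(q * x, z)\<close> and \<open>(y, q * w)\<close>,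
  divided by \<open>q\<close>. Lagrange's identity gives the gap as a square.\<close>

lemma weighted_cauchy_schwarz:
  fixes q :: real
  assumes "q > 0"
  shows "x * y + z * w \<le> sqrt (z\<^sup>2 + q\<^sup>2 * x\<^sup>2) * sqrt (y\<^sup>2 + q\<^sup>2 * w\<^sup>2) / q"
proof -
  have "(q * x) * y + z * (q * w) \<le> sqrt ((z\<^sup>2 + q\<^sup>2 * x\<^sup>2) * (y\<^sup>2 + q\<^sup>2 * w\<^sup>2))"
  proof (rule real_le_rsqrt)
    have "(z\<^sup>2 + q\<^sup>2 * x\<^sup>2) * (y\<^sup>2 + q\<^sup>2 * w\<^sup>2) - ((q * x) * y + z * (q * w))\<^sup>2 = (z * y - q * x * (q * w))\<^sup>2"
      by algebra
    then show "((q * x) * y + z * (q * w))\<^sup>2 \<le> (z\<^sup>2 + q\<^sup>2 * x\<^sup>2) * (y\<^sup>2 + q\<^sup>2 * w\<^sup>2)"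
      by (metis diff_ge_0_iff_ge zero_le_power2)
  qed
  moreover have "(q * x) * y + z * (q * w) = (x * y + z * w) * q" by algebra
  ultimately show ?thesis using assms by (simp only: real_sqrt_mult pos_le_divide_eq)
qed

text \<open>The two hypotheses bound |av|^2 + q^2 |bv|^2 by \<open>c * q\<close> at the basis
  vectors. For a diagonal pair this quantity is a combination of those two values with weights
  |v1|^2 and |v2|^2, so the bound \<open>c * q\<close> times |v|^2 holds for every
  \<open>v\<close>.\<close>

lemma op_norm_T_op_diag2_le:
  assumes q: "q > 0"
    and 1: "(cmod a1)\<^sup>2 + q\<^sup>2 * (cmod b1)\<^sup>2 \<le> c * q" and 2: "(cmod a2)\<^sup>2 + q\<^sup>2 * (cmod b2)\<^sup>2 \<le> c * q"
  shows "op_norm (T_op (diag2 a1 a2) (diag2 b1 b2) x) \<le> c * op_norm x"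
proof (rule op_norm_le)
  let ?a = "diag2 a1 a2" and ?b = "diag2 b1 b2"
  fix v
  \<comment> \<open>The image is paired with itself: |y|^2 is bounded by a multiple of |y|, and one
    factor |y| cancels at the end.\<close>
  define y where "y = T_op ?a ?b x *v v"
  have "0 \<le> c * q" using 1 by (rule order_trans[rotated]) simp
  then have c: "0 \<le> c" using q by (simp add: zero_le_mult_iff)
  \<comment> \<open>The factor moved to the other side of the inner product is an adjoint; for a
    diagonal matrix the adjoint gives vectors of the same length.\<close>
  have adj: "norm (conj_transpose (diag2 r s) *v w) = norm (diag2 r s *v w)" for r s w
    by (rule power2_eq_imp_eq) (simp_all add: norm_complex_2 norm_mult)
  have term_le: "inner ((diag2 r s ** x ** B) *v v) y \<le> op_norm x * (norm (B *v v) * norm (diag2 r s *v y))" for r s B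
  proof -
    have "inner ((diag2 r s ** x ** B) *v v) y = inner (x *v (B *v v)) (conj_transpose (diag2 r s) *v y)"
      by (simp only: inner_conj_transpose[symmetric] matrix_vector_mul_assoc matrix_mul_assoc)
    also have "\<dots> \<le> norm (x *v (B *v v)) * norm (diag2 r s *v y)"
      using norm_cauchy_schwarz adj by metis
    also have "\<dots> \<le> (op_norm x * norm (B *v v)) * norm (diag2 r s *v y)"
      by (intro mult_right_mono norm_mult_vec_le) simp
    finally show ?thesis by (simp add: mult.assoc)
  qed
  have F: "sqrt ((norm (?a *v w))\<^sup>2 + q\<^sup>2 * (norm (?b *v w))\<^sup>2) \<le> sqrt (c * q) * norm w" for w
  proof -
    have "(norm (?a *v w))\<^sup>2 + q\<^sup>2 * (norm (?b *v w))\<^sup>2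
        = ((cmod a1)\<^sup>2 + q\<^sup>2 * (cmod b1)\<^sup>2) * (cmod (w $ 1))\<^sup>2 + ((cmod a2)\<^sup>2 + q\<^sup>2 * (cmod b2)\<^sup>2) * (cmod (w $ 2))\<^sup>2"
      by (simp add: norm_complex_2 norm_mult power_mult_distrib algebra_simps)
    also have "\<dots> \<le> (c * q) * (cmod (w $ 1))\<^sup>2 + (c * q) * (cmod (w $ 2))\<^sup>2"
      by (intro add_mono mult_right_mono 1 2) simp_all
    also have "\<dots> = (c * q) * (norm w)\<^sup>2" by (simp add: norm_complex_2 algebra_simps)
    finally show ?thesis using real_sqrt_le_mono by (fastforce simp: real_sqrt_mult)
  qed
  have "norm y * norm y = inner ((?a ** x ** ?b) *v v) y + inner ((?b ** x ** ?a) *v v) y"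
    unfolding y_def T_op_def
    unfolding power2_eq_square[symmetric] power2_norm_eq_inner
    by (simp only: matrix_vector_mult_add_rdistrib inner_add_left)
  also have "\<dots> \<le> op_norm x * (norm (?b *v v) * norm (?a *v y) + norm (?a *v v) * norm (?b *v y))"
    using term_le[of a1 a2 ?b] term_le[of b1 b2 ?a] by (simp add: distrib_left)
  also have "\<dots> \<le> op_norm x * (sqrt ((norm (?a *v v))\<^sup>2 + q\<^sup>2 * (norm (?b *v v))\<^sup>2)
      * sqrt ((norm (?a *v y))\<^sup>2 + q\<^sup>2 * (norm (?b *v y))\<^sup>2) / q)"
    by (intro mult_left_mono weighted_cauchy_schwarz q op_norm_nonneg)
  also have "\<dots> \<le> op_norm x * ((sqrt (c * q) * norm v) * (sqrt (c * q) * norm y) / q)"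
    using q c by (intro mult_left_mono divide_right_mono mult_mono F op_norm_nonneg) simp_all
  also have "\<dots> = (c * op_norm x * norm v) * norm y"
    using q c by (simp add: real_sqrt_mult field_simps)
  finally have "norm y * norm y \<le> (c * op_norm x * norm v) * norm y" .
  then show "norm (T_op ?a ?b x *v v) \<le> c * op_norm x * norm v"
    unfolding y_def[symmetric] using c op_norm_nonneg[of x] by (cases "norm y = 0") auto
qed

section \<open>Exact norms for diagonal pairs, on which \<open>T_op\<close> acts as an entrywise
  multiplier\<close>

lemma T_op_diag2:
  "T_op (diag2 a1 a2) (diag2 b1 b2) (mat2 p q r s)
     = mat2 (2 * a1 * b1 * p) ((a1 * b2 + a2 * b1) * q) ((a1 * b2 + a2 * b1) * r) (2 * a2 * b2 * s)"
  by (simp add: T_op_def matrix_2_eq_iff algebra_simps)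

lemma superop_norm_diag2_common1:
  assumes "cmod a2 \<le> cmod a1" "cmod b2 \<le> cmod b1" "a1 \<noteq> 0" "b1 \<noteq> 0"
  shows "superop_norm (T_op (diag2 a1 a2) (diag2 b1 b2)) = 2 * cmod a1 * cmod b1"
proof (rule superop_norm_eqI)
  \<comment> \<open>This \<open>q\<close> makes |a1|^2 and q^2 |b1|^2 equal, so the bound at index 1
    is exact; index 2 is dominated term by term.\<close>
  define q where "q = cmod a1 / cmod b1"
  have q: "q > 0" "q\<^sup>2 * (cmod b1)\<^sup>2 = (cmod a1)\<^sup>2" "2 * cmod a1 * cmod b1 * q = 2 * (cmod a1)\<^sup>2"
    using assms by (simp_all add: q_def field_simps power2_eq_square)
  show "op_norm (T_op (diag2 a1 a2) (diag2 b1 b2) x) \<le> 2 * cmod a1 * cmod b1 * op_norm x" for x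
  proof (rule op_norm_T_op_diag2_le[OF q(1)])
    have "(cmod a2)\<^sup>2 + q\<^sup>2 * (cmod b2)\<^sup>2 \<le> (cmod a1)\<^sup>2 + q\<^sup>2 * (cmod b1)\<^sup>2"
      using assms by (intro add_mono mult_left_mono power_mono) simp_all
    then show "(cmod a2)\<^sup>2 + q\<^sup>2 * (cmod b2)\<^sup>2 \<le> 2 * cmod a1 * cmod b1 * q"
      by (simp add: q)
  qed (simp add: q)
  show "2 * cmod a1 * cmod b1 * op_norm (diag2 1 0) \<le> op_norm (T_op (diag2 a1 a2) (diag2 b1 b2) (diag2 1 0))"
    by (simp add: T_op_diag2 op_norm_diag2 norm_mult)
  show "op_norm (diag2 1 0) > 0" by (simp add: op_norm_diag2)
qed

text \<open>The matrix \<open>x0\<close> below comes from requiring equality in the Cauchy-Schwarz steps of the upper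
  bound with \<open>v = w\<close>: for the optimal \<open>q\<close> it must send \<open>q b v\<close> to \<open>a\<^sup>* v\<close> and \<open>a v\<close> to
  \<open>q b\<^sup>* v\<close>, up to a common factor.\<close>

lemma superop_norm_diag2_balanced:
  fixes a1 a2 b1 b2 :: complex
  defines "A1 \<equiv> (cmod a1)\<^sup>2" and "A2 \<equiv> (cmod a2)\<^sup>2" and "B1 \<equiv> (cmod b1)\<^sup>2" and "B2 \<equiv> (cmod b2)\<^sup>2"
  assumes lt: "A2 < A1" "B1 < B2"
    and A: "0 \<le> A1 * B2 - 2 * A2 * B2 + A2 * B1" and B: "0 \<le> A1 * B2 - 2 * A1 * B1 + A2 * B1"
  shows "superop_norm (T_op (diag2 a1 a2) (diag2 b1 b2)) = (A1 * B2 - A2 * B1) / sqrt ((A1 - A2) * (B2 - B1))"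
proof -
  define P Q where PQ: "P = A1 - A2" "Q = B2 - B1"
  define A where "A = A1 * B2 - 2 * A2 * B2 + A2 * B1"
  define B where "B = A1 * B2 - 2 * A1 * B1 + A2 * B1"
  define c where "c = (A1 * B2 - A2 * B1) / sqrt (P * Q)"
  define d where "d = of_real Q * a2 * cnj a1 - of_real P * cnj b1 * b2"
  define g where "g = sqrt A * sqrt B"
  define x0 where "x0 = mat2 d (- of_real g) (- of_real g) (- cnj d)"
  \<comment> \<open>For the optimal \<open>q\<close>, with q^2 = P / Q, the condition |av| = q |bv|
    forces |v1|^2 : |v2|^2 = A : B. The hypotheses that both are nonnegative make the square roots
    meaningful.\<close>
  define v :: "complex ^ 2" where "v = vector [of_real (sqrt A), of_real (sqrt B)]"
  define m where "m = a1 * b2 - a2 * b1"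
  define K where "K = A1 * B2 - A2 * B1"
  have pos: "P > 0" "Q > 0" using lt by (simp_all add: PQ)
  have nn: "0 \<le> A2" "0 \<le> B1" by (simp_all add: A2_def B1_def)
  have AB: "0 \<le> A" "0 \<le> B" "A + B = 2 * (P * Q)"
    using A B by (simp_all add: A_def B_def PQ algebra_simps)
  have "A2 * B1 < A1 * B2" using lt nn by (intro mult_strict_mono') auto
  then have K: "K > 0" by (simp add: K_def)
  have "cmod (a2 * b1) < cmod (a1 * b2)"
    using lt unfolding A1_def A2_def B1_def B2_def
    by (auto simp: norm_mult intro!: mult_strict_mono' dest: power2_less_imp_less)
  then have m: "m \<noteq> 0" by (auto simp: m_def)
  have sq: "a1 * cnj a1 = of_real A1" "a2 * cnj a2 = of_real A2" "b1 * cnj b1 = of_real B1" "b2 * cnj b2 = of_real B2"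
    by (simp_all only: A1_def A2_def B1_def B2_def complex_norm_square)
  have g2: "g\<^sup>2 = A * B" using AB by (simp add: g_def power_mult_distrib)
  \<comment> \<open>After every squared modulus is written as a product with a conjugate, this is a
    polynomial identity in the entries and their conjugates.\<close>
  have "complex_of_real ((cmod d)\<^sup>2 + g\<^sup>2) = of_real (P * Q * (cmod m)\<^sup>2)"
    unfolding g2 of_real_add of_real_mult complex_norm_square d_def m_def PQ A_def B_def of_real_diff of_real_numeral
      sq[symmetric] complex_cnj_diff complex_cnj_mult complex_cnj_cnj complex_cnj_complex_of_real
    by algebra
  then have dg: "(cmod d)\<^sup>2 + g\<^sup>2 = P * Q * (cmod m)\<^sup>2" by (simp only: of_real_eq_iff)
  \<comment> \<open>The columns of \<open>x0\<close> are orthogonal and of equal length, so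
    \<open>x0\<close> is a multiple of a unitary matrix.\<close>
  have nx: "norm (x0 *v w) = sqrt (P * Q) * cmod m * norm w" for w
  proof (rule power2_eq_imp_eq)
    have "complex_of_real ((norm (x0 *v w))\<^sup>2) = of_real (((cmod d)\<^sup>2 + g\<^sup>2) * (norm w)\<^sup>2)"
      unfolding norm_complex_2 of_real_add of_real_mult complex_norm_square x0_def
      by (simp add: algebra_simps power2_eq_square)
    then show "(norm (x0 *v w))\<^sup>2 = (sqrt (P * Q) * cmod m * norm w)\<^sup>2"
      unfolding dg of_real_eq_iff using pos by (simp add: power_mult_distrib)
  qed (use pos in simp_all)
  have v: "v \<noteq> 0" "v $ 1 = of_real (sqrt A)" "v $ 2 = of_real (sqrt B)"
  proof -
    show *: "v $ 1 = of_real (sqrt A)" "v $ 2 = of_real (sqrt B)" by (simp_all add: v_def vector_2)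
    have "P * Q > 0" using pos by simp
    then have "\<not> (A = 0 \<and> B = 0)" using AB(3) by auto
    then show "v \<noteq> 0" using * by auto
  qed
  have "op_norm x0 \<ge> sqrt (P * Q) * cmod m" using op_norm_ge[OF nx v(1)] .
  moreover have "op_norm x0 \<le> sqrt (P * Q) * cmod m" by (rule op_norm_le) (simp add: nx)
  ultimately have ox: "op_norm x0 = sqrt (P * Q) * cmod m" by simp
  have s: "complex_of_real (sqrt A) * of_real (sqrt A) = of_real A" "complex_of_real (sqrt B) * of_real (sqrt B) = of_real B"
    using AB by (simp_all flip: of_real_mult)
  \<comment> \<open>These identities make \<open>v\<close> an eigenvector of the image of
    \<open>x0\<close> under \<open>T_op\<close>, with eigenvalue \<open>- (m * of_real K)\<close>;
    \<open>t1\<close> and \<open>t2\<close> are its two coordinates.\<close>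
  have e1: "2 * a1 * b1 * d - (a1 * b2 + a2 * b1) * of_real B = - (m * of_real K)"
    unfolding d_def m_def K_def PQ B_def of_real_add of_real_mult of_real_diff of_real_numeral sq[symmetric] by algebra
  have e2: "- (2 * a2 * b2 * cnj d) - (a1 * b2 + a2 * b1) * of_real A = - (m * of_real K)"
    unfolding d_def m_def K_def PQ A_def of_real_add of_real_mult of_real_diff of_real_numeral sq[symmetric]
      complex_cnj_diff complex_cnj_mult complex_cnj_cnj complex_cnj_complex_of_real by algebra
  have t1: "(T_op (diag2 a1 a2) (diag2 b1 b2) x0 *v v) $ 1 = of_real (sqrt A) * (- (m * of_real K))"
    unfolding e1[symmetric] s(2)[symmetric] by (simp add: x0_def T_op_diag2 v g_def algebra_simps)
  have t2: "(T_op (diag2 a1 a2) (diag2 b1 b2) x0 *v v) $ 2 = of_real (sqrt B) * (- (m * of_real K))"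
    unfolding e2[symmetric] s(1)[symmetric] by (simp add: x0_def T_op_diag2 v g_def algebra_simps)
  have "norm (T_op (diag2 a1 a2) (diag2 b1 b2) x0 *v v) = (cmod m * K) * norm v"
  proof (rule power2_eq_imp_eq)
    show "(norm (T_op (diag2 a1 a2) (diag2 b1 b2) x0 *v v))\<^sup>2 = (cmod m * K * norm v)\<^sup>2"
      unfolding norm_complex_2 t1 t2 power_mult_distrib v(2,3)
      using AB(1,2) K by (simp add: norm_mult power_mult_distrib algebra_simps)
  qed (use K in simp_all)
  then have lower: "cmod m * K \<le> op_norm (T_op (diag2 a1 a2) (diag2 b1 b2) x0)"
    using v(1) by (rule op_norm_ge)
  have "superop_norm (T_op (diag2 a1 a2) (diag2 b1 b2)) = c"
  proof (rule superop_norm_eqI)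
    \<comment> \<open>This choice makes |a1|^2 + q^2 |b1|^2 and |a2|^2 + q^2 |b2|^2 coincide, with
      common value \<open>K / Q = c * q\<close>.\<close>
    define q where "q = sqrt P / sqrt Q"
    have q: "q > 0" "q\<^sup>2 = P / Q" "c * q = K / Q"
      using pos by (simp_all add: q_def c_def K_def power_divide real_sqrt_mult)
    have "A1 + P / Q * B1 = K / Q" "A2 + P / Q * B2 = K / Q"
      using pos by (simp_all add: field_simps) (simp_all add: K_def PQ algebra_simps)
    then show "op_norm (T_op (diag2 a1 a2) (diag2 b1 b2) x) \<le> c * op_norm x" for x
      by (intro op_norm_T_op_diag2_le[OF q(1)]) (simp_all add: q A1_def A2_def B1_def B2_def)
    have "c * op_norm x0 = cmod m * K" using pos by (simp add: ox c_def K_def)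
    then show "c * op_norm x0 \<le> op_norm (T_op (diag2 a1 a2) (diag2 b1 b2) x0)" using lower by simp
    show "op_norm x0 > 0" using pos m by (simp add: ox)
  qed
  then show ?thesis by (simp add: c_def PQ)
qed

text \<open>With q = |a2| / |b2| the value at index 2 is \<open>2 * A2\<close>, and the inequality
  assumed says exactly that the value at index 1 is no larger. The bound is attained at the matrix
  unit of index 2.\<close>

lemma superop_norm_diag2_dominant:
  fixes a1 a2 b1 b2 :: complex
  defines "A1 \<equiv> (cmod a1)\<^sup>2" and "A2 \<equiv> (cmod a2)\<^sup>2" and "B1 \<equiv> (cmod b1)\<^sup>2" and "B2 \<equiv> (cmod b2)\<^sup>2"
  assumes nz: "a2 \<noteq> 0" "b2 \<noteq> 0" and A: "A1 * B2 + A2 * B1 \<le> 2 * A2 * B2"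
  shows "superop_norm (T_op (diag2 a1 a2) (diag2 b1 b2)) = 2 * cmod b2 * cmod a2"
proof (rule superop_norm_eqI)
  define q where "q = cmod a2 / cmod b2"
  have q: "q > 0" "q\<^sup>2 = A2 / B2" "2 * cmod b2 * cmod a2 * q = 2 * A2"
    using nz by (simp_all add: q_def A2_def B2_def power_divide power2_eq_square)
  have B2: "B2 > 0" using nz by (simp add: B2_def)
  then have "A1 + A2 / B2 * B1 \<le> 2 * A2" "A2 + A2 / B2 * B2 \<le> 2 * A2"
    using A by (simp_all add: field_simps)
  then show "op_norm (T_op (diag2 a1 a2) (diag2 b1 b2) x) \<le> 2 * cmod b2 * cmod a2 * op_norm x" for x
    by (intro op_norm_T_op_diag2_le[OF q(1)]) (unfold q A1_def[symmetric] A2_def[symmetric] B1_def[symmetric] B2_def[symmetric])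
  show "2 * cmod b2 * cmod a2 * op_norm (diag2 0 1) \<le> op_norm (T_op (diag2 a1 a2) (diag2 b1 b2) (diag2 0 1))"
    by (simp add: T_op_diag2 op_norm_diag2 norm_mult)
  show "op_norm (diag2 0 1) > 0" by (simp add: op_norm_diag2)
qed

text \<open>If |a2| < |a1| and |b1| < |b2|, norming vectors of \<open>a\<close> have second
  coordinate 0 and those of \<open>b\<close> have first coordinate 0. Otherwise a basis vector
  serves both.\<close>

lemma common_norming_vector_diag2_iff:
  assumes "cmod a2 \<le> cmod a1"
  shows "common_norming_vector (diag2 a1 a2) (diag2 b1 b2) \<longleftrightarrow> cmod a1 = cmod a2 \<or> cmod b2 \<le> cmod b1"
    (is "?L \<longleftrightarrow> ?R")
proof
  assume ?L
  then obtain v where v: "norm v = 1" "norm (diag2 a1 a2 *v v) = cmod a1"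
    "norm (diag2 b1 b2 *v v) = max (cmod b1) (cmod b2)"
    using assms by (auto simp: common_norming_vector_def op_norm_diag2)
  have v1: "(cmod (v $ 1))\<^sup>2 = 1 - (cmod (v $ 2))\<^sup>2" using v(1) norm_complex_2[of v] by simp
  show ?R
  proof (rule ccontr)
    assume "\<not> ?R"
    then have lt: "(cmod a2)\<^sup>2 < (cmod a1)\<^sup>2" "(cmod b1)\<^sup>2 < (cmod b2)\<^sup>2" "max (cmod b1) (cmod b2) = cmod b2"
      using assms by (auto intro!: power_strict_mono)
    have "(cmod a1)\<^sup>2 = (cmod a1)\<^sup>2 * (cmod (v $ 1))\<^sup>2 + (cmod a2)\<^sup>2 * (cmod (v $ 2))\<^sup>2"
      using norm_complex_2[of "diag2 a1 a2 *v v"] unfolding v(2) by (simp add: norm_mult power_mult_distrib)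
    then have "((cmod a1)\<^sup>2 - (cmod a2)\<^sup>2) * (cmod (v $ 2))\<^sup>2 = 0" unfolding v1 by (simp add: algebra_simps)
    moreover have "(cmod b2)\<^sup>2 = (cmod b1)\<^sup>2 * (cmod (v $ 1))\<^sup>2 + (cmod b2)\<^sup>2 * (cmod (v $ 2))\<^sup>2"
      using norm_complex_2[of "diag2 b1 b2 *v v"] unfolding v(3) lt(3) by (simp add: norm_mult power_mult_distrib)
    ultimately show False using lt v1 by auto
  qed
next
  have n: "norm (axis i 1 :: complex ^ 2) = 1" for i by simp
  have "norm (diag2 p s *v axis 1 1) = cmod p" "norm (diag2 p s *v axis 2 1) = cmod s" for p s
    by (rule power2_eq_imp_eq, simp_all add: norm_complex_2 axis_def)+
  note N = this
  assume ?R
  then consider "cmod b2 \<le> cmod b1" | "cmod a1 = cmod a2" "cmod b1 \<le> cmod b2" by linarith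
  then show ?L
  proof cases
    case 1
    show ?thesis unfolding common_norming_vector_def op_norm_diag2
      by (rule exI[of _ "axis 1 1"]) (use 1 assms N n in \<open>simp add: max_absorb1\<close>)
  next
    case 2
    show ?thesis unfolding common_norming_vector_def op_norm_diag2
      by (rule exI[of _ "axis 2 1"]) (use 2 assms N n in \<open>simp add: max_absorb2\<close>)
  qed
qed

section \<open>Translation of the norm conditions into conditions on eigenvalues\<close>

theorem proposition11:
  fixes a b :: "complex ^ 2 ^ 2"
  assumes "a \<noteq> 0" and "b \<noteq> 0"
    and "a ** b = b ** a"
    and "normal_op a" and "normal_op b"
    and "hs_norm a / op_norm a \<ge> hs_norm b / op_norm b"
  shows "(common_norming_vector a b \<longrightarrow>
           superop_norm (T_op a b) = 2 * op_norm a * op_norm b) \<and>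
         (\<not> common_norming_vector a b \<longrightarrow>
           (if hs_norm a \<ge> sqrt (3 / 2) * op_norm a \<and>
               (hs_norm b)\<^sup>2 < 3 * (op_norm b)\<^sup>2
                 - (op_norm a)\<^sup>2 * (op_norm b)\<^sup>2 / ((hs_norm a)\<^sup>2 - (op_norm a)\<^sup>2)
            then superop_norm (T_op a b) =
                   2 * op_norm b * sqrt ((hs_norm a)\<^sup>2 - (op_norm a)\<^sup>2)
            else superop_norm (T_op a b) =
                   ((hs_norm a)\<^sup>2 * (op_norm b)\<^sup>2 + (op_norm a)\<^sup>2 * (hs_norm b)\<^sup>2
                      - (hs_norm a)\<^sup>2 * (hs_norm b)\<^sup>2)
                   / sqrt ((2 * (op_norm a)\<^sup>2 - (hs_norm a)\<^sup>2)
                             * (2 * (op_norm b)\<^sup>2 - (hs_norm b)\<^sup>2))))"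
proof -
  obtain U a1 a2 b1 b2 where U: "unitary U" and ab: "a = conjugate U (diag2 a1 a2)" "b = conjugate U (diag2 b1 b2)"
    and le: "cmod a2 \<le> cmod a1"
    using commuting_normal_diagonalizable_ordered[OF assms(4,5,3)] .
  define A1 A2 B1 B2 where d: "A1 = (cmod a1)\<^sup>2" "A2 = (cmod a2)\<^sup>2" "B1 = (cmod b1)\<^sup>2" "B2 = (cmod b2)\<^sup>2"
  let ?N = "superop_norm (T_op a b)"
  have nz: "a1 \<noteq> 0" "b1 \<noteq> 0 \<or> b2 \<noteq> 0"
    using assms(1,2) le by (auto simp: ab conjugate_def matrix_2_eq_iff)
  have N: "?N = superop_norm (T_op (diag2 a1 a2) (diag2 b1 b2))"
    unfolding ab by (rule superop_norm_conjugate[OF U])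
  have cnv: "common_norming_vector a b \<longleftrightarrow> cmod a1 = cmod a2 \<or> cmod b2 \<le> cmod b1"
    unfolding ab common_norming_vector_conjugate[OF U] by (rule common_norming_vector_diag2_iff[OF le])
  have na: "op_norm a = cmod a1" and nb: "op_norm b = max (cmod b1) (cmod b2)"
    using le by (simp_all add: ab op_norm_conjugate[OF U] op_norm_diag2)
  have ha: "(hs_norm a)\<^sup>2 = A1 + A2" and hb: "(hs_norm b)\<^sup>2 = B1 + B2"
    by (simp_all add: ab hs_norm_conjugate[OF U] hs_norm_diag2_sq d)
  have hs_nonneg: "hs_norm A \<ge> 0" for A
    by (auto simp: hs_norm_def trace_def sum_2)
  show ?thesis
  proof (intro conjI impI)
    assume "common_norming_vector a b"
    then consider "cmod b2 \<le> cmod b1" | "cmod a1 = cmod a2" "cmod b1 < cmod b2"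
      using cnv by linarith
    then show "?N = 2 * op_norm a * op_norm b"
    proof cases
      case 1
      then show ?thesis using superop_norm_diag2_common1[OF le 1 nz(1)] nz(2) by (force simp: N na nb)
    next
      case 2
      then have "a2 \<noteq> 0" "b2 \<noteq> 0" using nz(1) by auto
      \<comment> \<open>Here |a| is attained at both indices and |b| at index 2, so index 2 is
        dominant.\<close>
      moreover have "(cmod a1)\<^sup>2 * (cmod b2)\<^sup>2 + (cmod a2)\<^sup>2 * (cmod b1)\<^sup>2 \<le> 2 * (cmod a2)\<^sup>2 * (cmod b2)\<^sup>2"
        using 2 by (simp add: mult_left_mono power_mono)
      ultimately show ?thesis using superop_norm_diag2_dominant 2 by (simp add: N na nb)
    qed
  next
    assume "\<not> common_norming_vector a b"
    \<comment> \<open>From here on |a|^2 = A1 and |b|^2 = B2, and subtracting these from the squared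
      Hilbert-Schmidt norms leaves A2 and B1.\<close>
    then have lt: "cmod a2 < cmod a1" "cmod b1 < cmod b2" using cnv le by auto
    then have lt2: "A2 < A1" "B1 < B2" and nn: "0 \<le> A2" "0 \<le> B1" by (simp_all add: d power_strict_mono)
    have nb': "op_norm b = cmod b2" using lt nb by simp
    have na2: "(op_norm a)\<^sup>2 = A1" and nb2: "(op_norm b)\<^sup>2 = B2" by (simp_all add: na nb' d)
    have p: "0 < A1" "0 < B2" using lt2 nn by simp_all
    have "(hs_norm b / op_norm b)\<^sup>2 \<le> (hs_norm a / op_norm a)\<^sup>2"
      using assms(6) by (intro power_mono divide_nonneg_nonneg hs_nonneg op_norm_nonneg)
    then have h: "A1 * B1 \<le> A2 * B2" using p by (simp add: power_divide ha hb na2 nb2 field_simps)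
    have c1: "hs_norm a \<ge> sqrt (3 / 2) * op_norm a \<longleftrightarrow> A1 \<le> 2 * A2"
    proof -
      have "hs_norm a \<ge> sqrt (3 / 2) * op_norm a \<longleftrightarrow> (sqrt (3 / 2) * op_norm a)\<^sup>2 \<le> (hs_norm a)\<^sup>2"
        by (meson abs_le_square_iff hs_nonneg op_norm_nonneg power2_le_imp_le power_mono mult_nonneg_nonneg
            real_sqrt_ge_zero divide_nonneg_nonneg zero_le_numeral)
      then show ?thesis by (simp add: power_mult_distrib ha na2 field_simps)
    qed
    let ?c = "hs_norm a \<ge> sqrt (3 / 2) * op_norm a \<and> (hs_norm b)\<^sup>2 < 3 * (op_norm b)\<^sup>2
                 - (op_norm a)\<^sup>2 * (op_norm b)\<^sup>2 / ((hs_norm a)\<^sup>2 - (op_norm a)\<^sup>2)"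
    \<comment> \<open>If A1 <= 2 A2, then A2 > 0 and the strict inequality can be multiplied by A2.
      Otherwise both sides are false, so a division by A2 = 0 does no harm.\<close>
    have c: "?c \<longleftrightarrow> A1 * B2 - 2 * A2 * B2 + A2 * B1 < 0"
    proof (cases "A1 \<le> 2 * A2")
      case True
      then have "A2 > 0" using p by simp
      then show ?thesis using True unfolding c1 ha hb na2 nb2 by (simp add: field_simps)
    next
      case False
      then have "0 \<le> (A1 - 2 * A2) * B2 + A2 * B1" using p nn by simp
      then show ?thesis using False unfolding c1 by (simp add: algebra_simps)
    qed
    show "if ?c then ?N = 2 * op_norm b * sqrt ((hs_norm a)\<^sup>2 - (op_norm a)\<^sup>2)
      else ?N = ((hs_norm a)\<^sup>2 * (op_norm b)\<^sup>2 + (op_norm a)\<^sup>2 * (hs_norm b)\<^sup>2 - (hs_norm a)\<^sup>2 * (hs_norm b)\<^sup>2)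
        / sqrt ((2 * (op_norm a)\<^sup>2 - (hs_norm a)\<^sup>2) * (2 * (op_norm b)\<^sup>2 - (hs_norm b)\<^sup>2))"
    proof (cases ?c)
      case True
      then have A: "A1 * B2 + A2 * B1 \<le> 2 * A2 * B2" unfolding c by simp
      have "0 < A1 * B2" "0 \<le> A2 * B1" using p nn by simp_all
      then have "A2 \<noteq> 0" using A by auto
      then have "?N = 2 * cmod b2 * cmod a2"
        unfolding N using A p by (intro superop_norm_diag2_dominant) (auto simp: d)
      then show ?thesis using True by (simp only: if_True ha na2) (simp add: nb' d)
    next
      case False
      then have A: "0 \<le> A1 * B2 - 2 * A2 * B2 + A2 * B1" unfolding c by simp
      \<comment> \<open>This expression exceeds the one in \<open>A\<close> by 2 (A2 B2 - A1 B1),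
        which is nonnegative by the assumed order of the norm ratios.\<close>
      then have B: "0 \<le> A1 * B2 - 2 * A1 * B1 + A2 * B1" using h by simp
      have "?N = (A1 * B2 - A2 * B1) / sqrt ((A1 - A2) * (B2 - B1))"
        unfolding N using superop_norm_diag2_balanced lt2 A B unfolding d by blast
      then show ?thesis using False by (simp only: if_False ha hb na2 nb2) (simp add: algebra_simps)
    qed
  qed
qed

end
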